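(* Let $C$ be any circle in the Euclidean plane $\mathbb{R}^2$ (with arbitrary center) whose radius is a positive rational number. Then $C$ is densely hyperbolic rational approximable: there exist a positive rational $l$ and an $l$-hyperbolic rational set $Y\subseteq C$ such that $\overline{Y}=C$.
   Context: All distances are Euclidean. A subset $Y$ of a metric space $(M,d)$ is a rational set if $d(x,y)\in\mathbb{Q}^{+}\cup\{0\}$ for all $x,y\in Y$. A rational number $r=p/q$ with $p,q\in\mathbb{Z}$, $\gcd(p,q)=1$, is called a hyperbolic rational if $p^2-q^2=\pm m^2$ for some integer $m$; let $\mathbb{Q}_{hyperbolic}$ be the set of hyperbolic rationals and $\mathbb{Q}^{+}_{hyperbolic}$ its positive elements. For a positive rational $l$, a set $Y$ is an $l$-hyperbolic rational set if it is a rational set and there exists a point $P\in Y$ such that $\{d(P,x)\mid x\in Y\}\subseteq l\,(\mathbb{Q}^{+}_{hyperbolic}\cup\{0\})$. *)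

theory Defs
  imports "HOL-Analysis.Analysis"
begin

definition pos_rationals :: "real set" where
  "pos_rationals = {x \<in> \<rat>. 0 < x}"

definition rational_set :: "'a::metric_space set \<Rightarrow> bool" where
  "rational_set Y \<longleftrightarrow> (\<forall>x\<in>Y. \<forall>y\<in>Y. dist x y \<in> pos_rationals \<union> {0})"

text \<open>The value \<open>m = 0\<close> is allowed, so \<open>1\<close> is a hyperbolic rational.\<close>

definition hyperbolic_rationals :: "real set" where
  "hyperbolic_rationals =
     {r. \<exists>p q :: int. q \<noteq> 0 \<and> coprime p q \<and> r = of_int p / of_int q \<and>
           (\<exists>m :: int. p\<^sup>2 - q\<^sup>2 = m\<^sup>2 \<or> p\<^sup>2 - q\<^sup>2 = - (m\<^sup>2))}"

definition pos_hyperbolic_rationals :: "real set" where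
  "pos_hyperbolic_rationals = {r \<in> hyperbolic_rationals. 0 < r}"

text \<open>The parameter \<open>l\<close> is meant to range over \<open>pos_rationals\<close>; the condition is imposed where the
  notion is used.\<close>

definition hyperbolic_rational_set :: "real \<Rightarrow> 'a::metric_space set \<Rightarrow> bool" where
  "hyperbolic_rational_set l Y \<longleftrightarrow>
     rational_set Y \<and>
     (\<exists>P\<in>Y. {dist P x | x. x \<in> Y} \<subseteq> (\<lambda>h. l * h) ` (pos_hyperbolic_rationals \<union> {0}))"

text \<open>The closure is taken in the ambient space, so \<open>S\<close> is necessarily closed; for a closed \<open>S\<close>, such
  as a circle, this agrees with density of \<open>Y\<close> in the subspace \<open>S\<close>.\<close>

definition densely_hyperbolic_rational_approximable :: "'a::metric_space set \<Rightarrow> bool" where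
  "densely_hyperbolic_rational_approximable S \<longleftrightarrow>
     (\<exists>l \<in> pos_rationals. \<exists>Y \<subseteq> S. hyperbolic_rational_set l Y \<and> closure Y = S)"

end

theory Submission
  imports Defs
begin

text \<open>
  The points at angles \<open>2\<theta>\<close> and \<open>2\<phi>\<close> of a circle of radius \<open>r\<close> are at distance
  \<open>2r |sin (\<theta> - \<phi>)|\<close>. So the points for which \<open>cos \<theta>\<close> and \<open>sin \<theta>\<close> are rational form a rational
  set, and they are dense because rational points are dense on the unit circle. The distance from
  the point at angle \<open>0\<close> is \<open>2r |sin \<theta>|\<close>; here \<open>sin \<theta> = p/q\<close> is a hyperbolic rational because
  \<open>q\<^sup>2 - p\<^sup>2\<close> is the square of \<open>q cos \<theta>\<close>. Hence \<open>l = 2r\<close> works.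
\<close>

text \<open>In lowest terms \<open>a / b\<close>, an integral square means that
  \<open>b\<^sup>2\<close> divides \<open>a\<^sup>2\<close>, so \<open>b\<close> divides
  \<open>a\<close> and coprimality leaves \<open>b = 1\<close>.\<close>

lemma Ints_if_power2_Ints:
  fixes x :: real
  assumes "x \<in> \<rat>" "x\<^sup>2 \<in> \<int>"
  shows "x \<in> \<int>"
proof -
  obtain a b :: int where ab: "b > 0" "coprime a b" "x = of_int a / of_int b"
    using assms(1) by (rule Rats_cases')
  obtain n :: int where n: "x\<^sup>2 = of_int n"
    using assms(2) by (elim Ints_cases)
  have "(of_int (a\<^sup>2) :: real) = of_int (n * b\<^sup>2)"
    using n ab(1,3) by (simp add: field_simps)
  then have "a\<^sup>2 = n * b\<^sup>2"
    by (simp only: of_int_eq_iff)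
  then have "b\<^sup>2 dvd a\<^sup>2"
    by simp
  then have "b dvd a"
    by simp
  then have "b = 1"
    using ab(1,2) by (simp add: coprime_absorb_right)
  then show ?thesis
    using ab(3) by simp
qed

text \<open>For \<open>\<bar>x\<bar> = p / q\<close> in lowest terms, \<open>q * y\<close> is
  rational with the integral square \<open>q\<^sup>2 - p\<^sup>2\<close>. So it is an integer and
  serves as the witness \<open>m\<close>.\<close>

lemma abs_in_hyperbolic_rationals:
  fixes x y :: real
  assumes "x \<in> \<rat>" "y \<in> \<rat>" "x\<^sup>2 + y\<^sup>2 = 1"
  shows "\<bar>x\<bar> \<in> hyperbolic_rationals"
proof -
  have "\<bar>x\<bar> \<in> \<rat>"
    using assms(1) by simp
  then obtain p q :: int where pq: "q > 0" "coprime p q" "\<bar>x\<bar> = of_int p / of_int q"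
    by (rule Rats_cases')
  have "x\<^sup>2 = (of_int p / of_int q)\<^sup>2"
    using pq(3) by (metis power2_abs)
  then have "y\<^sup>2 = 1 - (of_int p / of_int q)\<^sup>2"
    using assms(3) by linarith
  then have eq: "(of_int q * y)\<^sup>2 = of_int (q\<^sup>2 - p\<^sup>2)"
    using pq(1) by (simp add: power_mult_distrib power_divide field_simps)
  moreover have "of_int q * y \<in> \<rat>"
    using assms(2) by simp
  ultimately have "of_int q * y \<in> \<int>"
    by (metis Ints_if_power2_Ints Ints_of_int)
  then obtain m where "of_int q * y = of_int m"
    by (elim Ints_cases)
  then have "(of_int (m\<^sup>2) :: real) = of_int (q\<^sup>2 - p\<^sup>2)"
    using eq by simp
  then have "p\<^sup>2 - q\<^sup>2 = - (m\<^sup>2)"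
    by (simp only: of_int_eq_iff)
  then show ?thesis
    unfolding hyperbolic_rationals_def mem_Collect_eq using pq
    by (intro exI[of _ p] exI[of _ q] conjI exI[of _ m] disjI2) simp_all
qed

text \<open>Complex squaring doubles the angle, so for \<open>(a, b) = (cos \<theta>, sin \<theta>)\<close> the following is the
  point at angle \<open>2\<theta>\<close>.\<close>

definition circle_point :: "real ^ 2 \<Rightarrow> real \<Rightarrow> real \<Rightarrow> real \<Rightarrow> real ^ 2" where
  "circle_point c r a b = c + r *\<^sub>R vector [a\<^sup>2 - b\<^sup>2, 2 * a * b]"

lemma dist_vec2:
  fixes x y :: "real ^ 2"
  shows "dist x y = sqrt ((x $ 1 - y $ 1)\<^sup>2 + (x $ 2 - y $ 2)\<^sup>2)"
  by (simp add: dist_vec_def L2_set_def sum_2 dist_real_def)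

lemma circle_point_in_sphere:
  assumes "a\<^sup>2 + b\<^sup>2 = 1" "0 \<le> r"
  shows "circle_point c r a b \<in> sphere c r"
proof -
  have "(r * (a\<^sup>2 - b\<^sup>2))\<^sup>2 + (r * (2 * a * b))\<^sup>2 = (r * (a\<^sup>2 + b\<^sup>2))\<^sup>2"
    by algebra
  then show ?thesis
    using assms by (simp add: circle_point_def dist_vec2)
qed

text \<open>For unit complex numbers z = a + ib and w = a' + ib', dividing z^2 - w^2 by zw gives
  |z^2 - w^2| = |z/w - w/z| = 2 |Im (z/w)|.\<close>

lemma dist_circle_point:
  assumes "a\<^sup>2 + b\<^sup>2 = 1" "a'\<^sup>2 + b'\<^sup>2 = 1" "0 \<le> r"
  shows "dist (circle_point c r a b) (circle_point c r a' b') = 2 * r * \<bar>a * b' - a' * b\<bar>"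
proof -
  have "(r * (a\<^sup>2 - b\<^sup>2) - r * (a'\<^sup>2 - b'\<^sup>2))\<^sup>2 + (r * (2 * a * b) - r * (2 * a' * b'))\<^sup>2
      = (2 * r * (a * b' - a' * b))\<^sup>2"
    using assms(1,2) by algebra
  then show ?thesis
    using assms(3) by (simp add: circle_point_def dist_vec2 abs_mult)
qed

lemma one_plus_square_neq_0: "1 + t\<^sup>2 \<noteq> (0 :: real)"
  by (simp add: add_nonneg_eq_0_iff)

text \<open>Together with \<open>sin_param\<close> this is the tangent half-angle parametrization, t
  = tan (\<theta>/2), which sends rational t to rational points of the unit circle. It misses only
  (-1, 0).\<close>

definition cos_param :: "real \<Rightarrow> real" where
  "cos_param t = (1 - t\<^sup>2) / (1 + t\<^sup>2)"

definition sin_param :: "real \<Rightarrow> real" where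
  "sin_param t = 2 * t / (1 + t\<^sup>2)"

lemma param_on_unit_circle: "(cos_param t)\<^sup>2 + (sin_param t)\<^sup>2 = 1"
proof -
  have "(1 - t\<^sup>2)\<^sup>2 + (2 * t)\<^sup>2 = (1 + t\<^sup>2)\<^sup>2"
    by algebra
  then show ?thesis
    using one_plus_square_neq_0[of t]
    by (simp add: cos_param_def sin_param_def power_divide flip: add_divide_distrib)
qed

lemma param_Rats:
  assumes "t \<in> \<rat>"
  shows "cos_param t \<in> \<rat>" "sin_param t \<in> \<rat>"
  using assms by (simp_all add: cos_param_def sin_param_def)

lemma continuous_circle_point_param:
  "continuous_on UNIV (\<lambda>t. circle_point c r (cos_param t) (sin_param t))"
proof -
  have *: "continuous_on UNIV cos_param" "continuous_on UNIV sin_param"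
    unfolding cos_param_def sin_param_def
    by (intro continuous_intros ballI one_plus_square_neq_0)+
  \<comment> \<open>In this form continuity can be checked coordinate by coordinate.\<close>
  have vector_eq: "vector [x, y] = (\<chi> i :: 2. if i = 1 then x else y)" for x y :: real
    by (simp add: vec_eq_iff forall_2)
  have "continuous_on UNIV
      (\<lambda>t. vector [(cos_param t)\<^sup>2 - (sin_param t)\<^sup>2, 2 * cos_param t * sin_param t] :: real ^ 2)"
    unfolding vector_eq
  proof (rule continuous_on_vec_lambda)
    show "continuous_on UNIV (\<lambda>t. if i = 1 then (cos_param t)\<^sup>2 - (sin_param t)\<^sup>2
        else 2 * cos_param t * sin_param t)" for i :: 2
      using * by (cases "i = 1") (simp_all add: continuous_on_diff continuous_on_mult continuous_on_power)
  qed
  then show ?thesis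
    unfolding circle_point_def by (intro continuous_intros)
qed

text \<open>The missed point (-1, 0) costs nothing after doubling the angle: it has the same square
  as (1, 0), the point at t = 0.\<close>

lemma sphere_eq_circle_point_param:
  assumes "0 < r"
  shows "sphere c r = range (\<lambda>t. circle_point c r (cos_param t) (sin_param t))"
proof
  show "range (\<lambda>t. circle_point c r (cos_param t) (sin_param t)) \<subseteq> sphere c r"
    using assms param_on_unit_circle by (auto intro: circle_point_in_sphere simp del: mem_sphere)
  show "sphere c r \<subseteq> range (\<lambda>t. circle_point c r (cos_param t) (sin_param t))"
  proof
    fix x assume "x \<in> sphere c r"
    then have "(x $ 1 - c $ 1)\<^sup>2 + (x $ 2 - c $ 2)\<^sup>2 = r\<^sup>2"
      by (auto simp: dist_vec2 power2_commute)
    then have "((x $ 1 - c $ 1) / r)\<^sup>2 + ((x $ 2 - c $ 2) / r)\<^sup>2 = 1"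
      using assms by (simp add: power_divide flip: add_divide_distrib)
    then obtain \<alpha> where \<alpha>: "0 \<le> \<alpha>" "\<alpha> < 2 * pi"
      "(x $ 1 - c $ 1) / r = cos \<alpha>" "(x $ 2 - c $ 2) / r = sin \<alpha>"
      by (rule sincos_total_2pi)
    \<comment> \<open>One halving undoes the squaring in \<open>circle_point\<close>, the other
      comes from the half-angle parameter. Since \<alpha> < 2 pi, \<beta> stays below pi/2, where
      the tangent is defined.\<close>
    define \<beta> where "\<beta> = \<alpha> / 4"
    have "cos \<beta> > 0"
      using \<alpha>(1,2) pi_gt_zero unfolding \<beta>_def by (intro cos_gt_zero_pi) linarith+
    then have param: "cos_param (tan \<beta>) = cos (\<alpha> / 2)" "sin_param (tan \<beta>) = sin (\<alpha> / 2)"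
      using cos_tan_half[of \<beta>] sin_tan_half[of \<beta>]
      by (simp_all add: cos_param_def sin_param_def \<beta>_def)
    have "x $ 1 = c $ 1 + r * cos \<alpha>" "x $ 2 = c $ 2 + r * sin \<alpha>"
      using \<alpha>(3,4) assms by (simp_all add: field_simps)
    then have "x = circle_point c r (cos (\<alpha> / 2)) (sin (\<alpha> / 2))"
      using cos_double[of "\<alpha> / 2"] sin_double[of "\<alpha> / 2"]
      by (simp add: circle_point_def vec_eq_iff forall_2 mult_ac)
    then show "x \<in> range (\<lambda>t. circle_point c r (cos_param t) (sin_param t))"
      by (intro image_eqI[of _ _ "tan \<beta>"]) (simp_all add: param)
  qed
qed

theorem theorem2p1:
  fixes c :: "real ^ 2" and r :: real
  assumes "r \<in> \<rat>" and "0 < r"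
  shows "densely_hyperbolic_rational_approximable (sphere c r)"
proof -
  define f where "f t = circle_point c r (cos_param t) (sin_param t)" for t
  have sphere: "sphere c r = range f"
    using sphere_eq_circle_point_param[OF assms(2)] by (simp add: f_def[abs_def])
  have subset: "f ` \<rat> \<subseteq> sphere c r"
    unfolding sphere by (rule image_mono) simp
  have dist_f: "dist (f s) (f t) = 2 * r * \<bar>cos_param s * sin_param t - cos_param t * sin_param s\<bar>" for s t
    unfolding f_def using assms(2) by (intro dist_circle_point param_on_unit_circle) simp
  have rational: "rational_set (f ` \<rat>)"
    using assms by (auto simp: rational_set_def pos_rationals_def dist_f param_Rats)
  \<comment> \<open>The base point is \<open>f 0\<close>, at angle 0: there \<open>cos_param\<close>
    is 1 and \<open>sin_param\<close> is 0, so the chord formula reduces to a single sine.\<close>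
  have "dist (f 0) (f t) \<in> (\<lambda>h. 2 * r * h) ` (pos_hyperbolic_rationals \<union> {0})" if "t \<in> \<rat>" for t
  proof -
    have "\<bar>sin_param t\<bar> \<in> hyperbolic_rationals"
      using param_on_unit_circle[of t] that
      by (intro abs_in_hyperbolic_rationals[of _ "cos_param t"] param_Rats) (simp_all add: add.commute)
    then have "\<bar>sin_param t\<bar> \<in> pos_hyperbolic_rationals \<union> {0}"
      by (auto simp: pos_hyperbolic_rationals_def)
    moreover have "dist (f 0) (f t) = 2 * r * \<bar>sin_param t\<bar>"
      by (simp add: dist_f) (simp add: cos_param_def sin_param_def)
    ultimately show ?thesis
      by blast
  qed
  then have "{dist (f 0) x | x. x \<in> f ` \<rat>} \<subseteq> (\<lambda>h. 2 * r * h) ` (pos_hyperbolic_rationals \<union> {0})"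
    by fast
  then have "hyperbolic_rational_set (2 * r) (f ` \<rat>)"
    unfolding hyperbolic_rational_set_def by (intro conjI rational bexI[of _ "f 0"]) simp_all
  moreover have "closure (f ` \<rat>) = sphere c r"
  proof
    show "closure (f ` \<rat>) \<subseteq> sphere c r"
      by (rule closure_minimal[OF subset closed_sphere])
    \<comment> \<open>Density passes from the parameter line to the circle by continuity, because
      the rationals are dense in the reals and \<open>f\<close> is onto the circle.\<close>
    have "f ` closure \<rat> \<subseteq> closure (f ` \<rat>)"
      using continuous_on_subset[OF continuous_circle_point_param[of c r]]
      by (intro image_closure_subset) (auto simp: f_def[abs_def] closure_subset)
    then show "sphere c r \<subseteq> closure (f ` \<rat>)"
      by (simp add: sphere Rats_closure_real)
  qed
  moreover have "2 * r \<in> pos_rationals"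
    using assms by (simp add: pos_rationals_def)
  ultimately show ?thesis
    using subset unfolding densely_hyperbolic_rational_approximable_def by blast
qed

end
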